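(* Consider the $N$-state delegation problem with Shannon information costs described in the context, with principal's prior $\mu_p$ satisfying $\mu_p(\omega_1)\ge\dots\ge\mu_p(\omega_N)$. The principal's restriction problem of choosing an agent's prior $\mu\in\Delta(\Omega)$ together with a nonempty delegation set $A^*\subseteq\mathcal A$, $$\max_{\mu,A^*}\ \sum_{j=1}^N\mu_p(\omega_j)\sum_{i=1}^N\pi(a_i|\omega_j)u(a_i,\omega_j)\quad\text{s.t. }\pi:\Omega\to\Delta(A^* )\text{ solves the agent's problem given }\mu\text{ and }A^*,$$ is solved by the unrestricted delegation set $A^*=\mathcal A$ together with the prior $\mu^*(\omega_i)=\sqrt{\mu_p(\omega_i)}\big/\sum_{j=1}^N\sqrt{\mu_p(\omega_j)}$, $i=1,\dots,N$.
   Context: $N>2$; states $\Omega=\{\omega_1,\dots,\omega_N\}$, actions $\mathcal A=\{a_1,\dots,a_N\}$, payoffs $u(a_i,\omega_i)=1$ and $u(a_i,\omega_j)=0$ for $i\ne j$. Agent's problem given $\mu\in\Delta(\Omega)$ and $A^*\subseteq\mathcal A$: choose $\pi:\Omega\to\Delta(A^* )$ (so $\pi(a|\omega)=0$ for $a\notin A^*$) to maximize $$\sum_j\mu(\omega_j)\sum_i\pi(a_i|\omega_j)u(a_i,\omega_j)-\lambda\sum_{j}\sum_{i}\mu(\omega_j)\pi(a_i|\omega_j)\ln\frac{\pi(a_i|\omega_j)}{\beta(a_i)},\qquad \beta(a_i)=\sum_j\mu(\omega_j)\pi(a_i|\omega_j),$$ with $\lambda>0$, $0\ln 0=0$ (the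 second term is the Shannon entropy cost of information). Solutions are taken to satisfy $$\pi(a_i|\omega_j)=\frac{\beta(a_i)e^{u(a_i,\omega_j)/\lambda}}{\sum_{a_k\in A^*}\beta(a_k)e^{u(a_k,\omega_j)/\lambda}}\quad\text{for all }a_i\in A^*\text{ and all }j$$ (automatic at states with $\mu(\omega_j)>0$; a convention at states with $\mu(\omega_j)=0$). The principal does not bear the information cost. *)

theory Defs
  imports Complex_Main
begin

text \<open>
  States and actions are both represented by their indices in \<open>{1..N}\<close>. A distribution over states
  is a function \<open>\<mu> :: nat \<Rightarrow> real\<close> and a choice rule is a function \<open>\<pi> :: nat \<Rightarrow> nat \<Rightarrow> real\<close> with
  \<open>\<pi> i j\<close> standing for the conditional probability of action \<open>a\<^sub>i\<close> in state \<open>\<omega>\<^sub>j\<close>; values at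
  indices outside \<open>{1..N}\<close> are irrelevant.
  The unit cost of information is \<open>\<kappa>\<close>, since \<open>\<lambda>\<close> is reserved for abstraction.
\<close>

definition payoff :: "nat \<Rightarrow> nat \<Rightarrow> real" where
  "payoff i j = (if i = j then 1 else 0)"

definition simplex :: "nat \<Rightarrow> (nat \<Rightarrow> real) set" where
  "simplex N = {\<mu>. (\<forall>j\<in>{1..N}. 0 \<le> \<mu> j) \<and> (\<Sum>j=1..N. \<mu> j) = 1}"

definition choice_rules :: "nat \<Rightarrow> nat set \<Rightarrow> (nat \<Rightarrow> nat \<Rightarrow> real) set" where
  "choice_rules N A = {\<pi>. \<forall>j\<in>{1..N}. (\<lambda>i. \<pi> i j) \<in> simplex N \<and> (\<forall>i\<in>{1..N} - A. \<pi> i j = 0)}"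

definition marginal :: "nat \<Rightarrow> (nat \<Rightarrow> real) \<Rightarrow> (nat \<Rightarrow> nat \<Rightarrow> real) \<Rightarrow> nat \<Rightarrow> real" where
  "marginal N \<mu> \<pi> i = (\<Sum>j=1..N. \<mu> j * \<pi> i j)"

definition expected_payoff :: "nat \<Rightarrow> (nat \<Rightarrow> real) \<Rightarrow> (nat \<Rightarrow> nat \<Rightarrow> real) \<Rightarrow> real" where
  "expected_payoff N \<mu> \<pi> = (\<Sum>j=1..N. \<mu> j * (\<Sum>i=1..N. \<pi> i j * payoff i j))"

text \<open>
  The convention \<open>0 ln 0 = 0\<close> holds because a zero factor precedes the logarithm. If the marginal of
  \<open>i\<close> vanishes, then so does \<open>\<mu> j * \<pi> i j\<close> for every \<open>j\<close>, so the totalised division by zero never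
  contributes.
\<close>

definition information_cost :: "nat \<Rightarrow> (nat \<Rightarrow> real) \<Rightarrow> (nat \<Rightarrow> nat \<Rightarrow> real) \<Rightarrow> real" where
  "information_cost N \<mu> \<pi> =
     (\<Sum>j=1..N. \<Sum>i=1..N. \<mu> j * \<pi> i j * ln (\<pi> i j / marginal N \<mu> \<pi> i))"

definition agent_objective ::
    "nat \<Rightarrow> real \<Rightarrow> (nat \<Rightarrow> real) \<Rightarrow> (nat \<Rightarrow> nat \<Rightarrow> real) \<Rightarrow> real" where
  "agent_objective N \<kappa> \<mu> \<pi> = expected_payoff N \<mu> \<pi> - \<kappa> * information_cost N \<mu> \<pi>"

text \<open>
  The logit condition follows from optimality at states of positive prior probability; requiring it
  at every state also fixes the choice rule at states of prior probability zero.
\<close>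

definition logit ::
    "nat \<Rightarrow> real \<Rightarrow> (nat \<Rightarrow> real) \<Rightarrow> nat set \<Rightarrow> (nat \<Rightarrow> nat \<Rightarrow> real) \<Rightarrow> bool" where
  "logit N \<kappa> \<mu> A \<pi> \<longleftrightarrow>
     (\<forall>i\<in>A. \<forall>j\<in>{1..N}.
        \<pi> i j = marginal N \<mu> \<pi> i * exp (payoff i j / \<kappa>)
                  / (\<Sum>k\<in>A. marginal N \<mu> \<pi> k * exp (payoff k j / \<kappa>)))"

definition solves_agent ::
    "nat \<Rightarrow> real \<Rightarrow> (nat \<Rightarrow> real) \<Rightarrow> nat set \<Rightarrow> (nat \<Rightarrow> nat \<Rightarrow> real) \<Rightarrow> bool" where
  "solves_agent N \<kappa> \<mu> A \<pi> \<longleftrightarrow>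
     \<pi> \<in> choice_rules N A \<and>
     (\<forall>\<pi>'\<in>choice_rules N A. agent_objective N \<kappa> \<mu> \<pi>' \<le> agent_objective N \<kappa> \<mu> \<pi>) \<and>
     logit N \<kappa> \<mu> A \<pi>"

definition feasible ::
    "nat \<Rightarrow> real \<Rightarrow> (nat \<Rightarrow> real) \<Rightarrow> nat set \<Rightarrow> (nat \<Rightarrow> nat \<Rightarrow> real) \<Rightarrow> bool" where
  "feasible N \<kappa> \<mu> A \<pi> \<longleftrightarrow>
     \<mu> \<in> simplex N \<and> A \<subseteq> {1..N} \<and> A \<noteq> {} \<and> solves_agent N \<kappa> \<mu> A \<pi>"

text \<open>
  The agent's problem can have several solutions for some priors and delegation sets. A pair solves
  the principal's problem if the agent has a solution there, and whichever one the agent uses, the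
  principal does at least as well as with any solution of the agent at any other admissible pair.
\<close>

definition solves_restriction_problem ::
    "nat \<Rightarrow> real \<Rightarrow> (nat \<Rightarrow> real) \<Rightarrow> (nat \<Rightarrow> real) \<Rightarrow> nat set \<Rightarrow> bool" where
  "solves_restriction_problem N \<kappa> \<mu>p \<mu> A \<longleftrightarrow>
     (\<exists>\<pi>. feasible N \<kappa> \<mu> A \<pi>) \<and>
     (\<forall>\<pi>. feasible N \<kappa> \<mu> A \<pi> \<longrightarrow>
        (\<forall>\<mu>' A' \<pi>'. feasible N \<kappa> \<mu>' A' \<pi>' \<longrightarrow>
           expected_payoff N \<mu>p \<pi>' \<le> expected_payoff N \<mu>p \<pi>))"

end

theory Submission
  imports Defs
begin

text \<open>
  Write \<open>d = exp (1/\<kappa>) - 1\<close> and let \<open>\<beta>\<close> be the marginal of a choice rule. By Gibbs' inequality the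
  agent's objective is at most \<open>\<kappa> (\<Sum>j. \<mu> j ln (1 + d \<beta> j))\<close>, with equality for logit rules, and under
  a logit rule action \<open>j\<close> is taken in state \<open>j\<close> with probability \<open>(1 + d) \<beta> j / (1 + d \<beta> j)\<close>. Hence
  both the agent and the principal maximize a concave separable function of \<open>\<beta>\<close> over the simplex. The
  agent's first-order condition is that \<open>\<mu> j / (1 + d \<beta> j)\<close> be constant on the support of \<open>\<beta>\<close> and
  no larger off it; the principal's is the same with \<open>\<mu>p j / (1 + d \<beta> j)\<^sup>2\<close>. The two coincide when
  \<open>\<mu>\<close> is proportional to the square root of \<open>\<mu>p\<close>.
\<close>

text \<open>Keeps the simplifier from rewriting the index sets \<open>{1..N}\<close> to \<open>{Suc 0..N}\<close>.\<close>

declare One_nat_def [simp del]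

section \<open>Logit weights, the simplex and choice rules\<close>

text \<open>The logit weight is 1 for a wrong action and exceeds 1 by this amount for the right
  one.\<close>

definition gain :: "real \<Rightarrow> real" where
  "gain \<kappa> = exp (1 / \<kappa>) - 1"

text \<open>The first-order condition of the agent, with multiplier \<open>d c\<close>.\<close>

definition waterfilling ::
    "nat \<Rightarrow> real \<Rightarrow> (nat \<Rightarrow> real) \<Rightarrow> real \<Rightarrow> (nat \<Rightarrow> real) \<Rightarrow> bool" where
  "waterfilling N d \<mu> c b \<longleftrightarrow> b \<in> simplex N \<and> 0 < c \<and>
     (\<forall>j\<in>{1..N}. \<mu> j \<le> c * (1 + d * b j) \<and> (0 < b j \<longrightarrow> \<mu> j = c * (1 + d * b j)))"

lemma gain_pos: "0 < \<kappa> \<Longrightarrow> 0 < gain \<kappa>"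
  by (simp add: gain_def)

lemma exp_payoff: "exp (payoff i j / \<kappa>) = 1 + (if i = j then gain \<kappa> else 0)"
  by (simp add: payoff_def gain_def)

lemma simplex_nonneg: "b \<in> simplex N \<Longrightarrow> j \<in> {1..N} \<Longrightarrow> 0 \<le> b j"
  by (simp add: simplex_def)

lemma simplex_sum: "b \<in> simplex N \<Longrightarrow> (\<Sum>j=1..N. b j) = 1"
  by (simp add: simplex_def)

lemma one_plus_gain_pos:
  assumes "0 < \<kappa>" "b \<in> simplex N" "j \<in> {1..N}"
  shows "0 < 1 + gain \<kappa> * b j"
  using mult_nonneg_nonneg[of "gain \<kappa>" "b j"] gain_pos[OF assms(1)] simplex_nonneg[OF assms(2,3)]
  by linarith

text \<open>The total mass of \<open>b\<close> gives the 1, and only the matching action adds to it,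
  so the normalizer in state \<open>j\<close> depends on \<open>b j\<close> alone.\<close>

lemma logit_normalizer:
  assumes "b \<in> simplex N" "j \<in> {1..N}"
  shows "(\<Sum>k=1..N. b k * exp (payoff k j / \<kappa>)) = 1 + gain \<kappa> * b j"
proof -
  have "(\<Sum>k=1..N. b k * exp (payoff k j / \<kappa>))
      = (\<Sum>k=1..N. b k + (if k = j then gain \<kappa> * b k else 0))"
    by (rule sum.cong) (auto simp: exp_payoff algebra_simps)
  also have "\<dots> = 1 + gain \<kappa> * b j"
    using assms by (simp add: sum.distrib simplex_sum sum.delta)
  finally show ?thesis .
qed

lemma choice_rule_nonneg:
  "\<pi> \<in> choice_rules N A \<Longrightarrow> i \<in> {1..N} \<Longrightarrow> j \<in> {1..N} \<Longrightarrow> 0 \<le> \<pi> i j"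
  by (auto simp: choice_rules_def simplex_def)

lemma choice_rule_sum:
  "\<pi> \<in> choice_rules N A \<Longrightarrow> j \<in> {1..N} \<Longrightarrow> (\<Sum>i=1..N. \<pi> i j) = 1"
  by (auto simp: choice_rules_def simplex_def)

lemma marginal_simplex:
  assumes "\<mu> \<in> simplex N" "\<pi> \<in> choice_rules N A"
  shows "marginal N \<mu> \<pi> \<in> simplex N"
proof -
  have "(\<Sum>i=1..N. marginal N \<mu> \<pi> i) = (\<Sum>j=1..N. \<Sum>i=1..N. \<mu> j * \<pi> i j)"
    unfolding marginal_def by (rule sum.swap)
  also have "\<dots> = (\<Sum>j=1..N. \<mu> j)"
    by (rule sum.cong) (simp_all add: choice_rule_sum[OF assms(2)] flip: sum_distrib_left)
  also have "\<dots> = 1"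
    using assms(1) by (rule simplex_sum)
  finally have "(\<Sum>i=1..N. marginal N \<mu> \<pi> i) = 1" .
  moreover have "0 \<le> marginal N \<mu> \<pi> i" if "i \<in> {1..N}" for i
    unfolding marginal_def
    using simplex_nonneg[OF assms(1)] choice_rule_nonneg[OF assms(2) that]
    by (intro sum_nonneg mult_nonneg_nonneg)
  ultimately show ?thesis
    by (simp add: simplex_def)
qed

lemma marginal_outside:
  "\<pi> \<in> choice_rules N A \<Longrightarrow> i \<in> {1..N} - A \<Longrightarrow> marginal N \<mu> \<pi> i = 0"
  by (auto simp: marginal_def choice_rules_def)

section \<open>Logit rules and the value of the agent's objective\<close>

text \<open>Actions outside \<open>A\<close> have marginal zero, so the normalizer may be summed
  over all actions. The delegation set thus drops out of the formula, which lets rules for different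
  sets be compared.\<close>

lemma logit_eq:
  assumes "\<mu> \<in> simplex N" "A \<subseteq> {1..N}" "\<pi> \<in> choice_rules N A" "logit N \<kappa> \<mu> A \<pi>"
    and i: "i \<in> {1..N}" and j: "j \<in> {1..N}"
  shows "\<pi> i j = marginal N \<mu> \<pi> i * exp (payoff i j / \<kappa>) / (1 + gain \<kappa> * marginal N \<mu> \<pi> j)"
proof (cases "i \<in> A")
  case True
  have "(\<Sum>k\<in>A. marginal N \<mu> \<pi> k * exp (payoff k j / \<kappa>))
      = (\<Sum>k=1..N. marginal N \<mu> \<pi> k * exp (payoff k j / \<kappa>))"
    using assms(2) marginal_outside[OF assms(3)] by (intro sum.mono_neutral_left) auto
  with True j show ?thesis
    using assms(4) logit_normalizer[OF marginal_simplex[OF assms(1,3)] j, of \<kappa>]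
    by (simp add: logit_def)
next
  case False
  with i j have "\<pi> i j = 0"
    using assms(3) by (auto simp: choice_rules_def)
  with False i show ?thesis
    using marginal_outside[OF assms(3)] by simp
qed

text \<open>Payoffs are evaluated under an arbitrary \<open>\<nu>\<close>, later the principal's
  prior; the agent's prior \<open>\<mu>\<close> matters only through the marginal it
  induces.\<close>

lemma logit_expected_payoff:
  assumes "\<mu> \<in> simplex N" "A \<subseteq> {1..N}" "\<pi> \<in> choice_rules N A" "logit N \<kappa> \<mu> A \<pi>"
  shows "expected_payoff N \<nu> \<pi> = (\<Sum>j=1..N. \<nu> j *
    ((1 + gain \<kappa>) * marginal N \<mu> \<pi> j / (1 + gain \<kappa> * marginal N \<mu> \<pi> j)))"
  unfolding expected_payoff_def
proof (rule sum.cong[OF refl])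
  fix j assume j: "j \<in> {1..N}"
  have "(\<Sum>i=1..N. \<pi> i j * payoff i j) = (\<Sum>i=1..N. if i = j then \<pi> j j else 0)"
    by (rule sum.cong) (auto simp: payoff_def)
  also have "\<dots> = \<pi> j j"
    using j by simp
  also have "\<dots> = (1 + gain \<kappa>) * marginal N \<mu> \<pi> j / (1 + gain \<kappa> * marginal N \<mu> \<pi> j)"
    using logit_eq[OF assms j j] by (simp add: exp_payoff mult.commute)
  finally show "\<nu> j * (\<Sum>i=1..N. \<pi> i j * payoff i j) = \<nu> j *
    ((1 + gain \<kappa>) * marginal N \<mu> \<pi> j / (1 + gain \<kappa> * marginal N \<mu> \<pi> j))"
    by simp
qed

lemma agent_objective_eq:
  assumes "\<kappa> > 0"
  shows "agent_objective N \<kappa> \<mu> \<pi> = \<kappa> * (\<Sum>j=1..N. \<mu> j *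
    (\<Sum>i=1..N. \<pi> i j * (payoff i j / \<kappa> - ln (\<pi> i j / marginal N \<mu> \<pi> i))))"
  using assms unfolding agent_objective_def expected_payoff_def information_cost_def
  by (simp add: sum_distrib_left sum_subtractf right_diff_distrib mult.left_commute mult.assoc)

text \<open>Gibbs' inequality, state by state: the choice rule is compared with the logit
  probabilities built from its own marginal.\<close>

lemma agent_objective_le:
  assumes "\<kappa> > 0" "\<mu> \<in> simplex N" "\<pi> \<in> choice_rules N A"
  shows "agent_objective N \<kappa> \<mu> \<pi> \<le>
    \<kappa> * (\<Sum>j=1..N. \<mu> j * ln (1 + gain \<kappa> * marginal N \<mu> \<pi> j))"
  unfolding agent_objective_eq[OF assms(1)]
proof (rule mult_left_mono[OF sum_mono])
  fix j assume j: "j \<in> {1..N}"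
  define b where "b = marginal N \<mu> \<pi>"
  define Z where "Z = 1 + gain \<kappa> * b j"
  have bS: "b \<in> simplex N"
    unfolding b_def using assms(2,3) by (rule marginal_simplex)
  have Z: "0 < Z"
    unfolding Z_def using assms(1) bS j by (rule one_plus_gain_pos)
  have "\<mu> j * (\<Sum>i=1..N. \<pi> i j * (payoff i j / \<kappa> - ln (\<pi> i j / b i))) \<le> \<mu> j * ln Z"
  \<comment> \<open>In a state of prior zero an action may have positive conditional probability but
    zero marginal, so the quotient inside the logarithm is meaningful only in the other
    case.\<close>
  proof (cases "\<mu> j = 0")
    case False
    then have muj: "0 < \<mu> j"
      using simplex_nonneg[OF assms(2) j] by simp
    have gibbs: "\<pi> i j * (payoff i j / \<kappa> - ln (\<pi> i j / b i) - ln Z)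
        \<le> b i * exp (payoff i j / \<kappa>) / Z - \<pi> i j" if i: "i \<in> {1..N}" for i
    proof (cases "\<pi> i j = 0")
      case True
      then show ?thesis
        using simplex_nonneg[OF bS i] Z by simp
    next
      case False
      then have p: "0 < \<pi> i j"
        using choice_rule_nonneg[OF assms(3) i j] by simp
      have "0 < \<mu> j * \<pi> i j"
        using muj p by simp
      also have "\<mu> j * \<pi> i j \<le> b i"
        unfolding b_def marginal_def
        using simplex_nonneg[OF assms(2)] choice_rule_nonneg[OF assms(3) i] j
        by (intro member_le_sum[where f = "\<lambda>j. \<mu> j * \<pi> i j"]) auto
      finally have bi: "0 < b i" .
      \<comment> \<open>The ratio of the logit probability to the actual one; Gibbs' inequality is
        \<open>ln x \<le> x - 1\<close> averaged over actions.\<close>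
      define x where "x = b i * exp (payoff i j / \<kappa>) / (Z * \<pi> i j)"
      have x: "0 < x"
        unfolding x_def using bi Z p by simp
      have "payoff i j / \<kappa> - ln (\<pi> i j / b i) - ln Z = ln x"
        unfolding x_def using bi Z p by (simp add: ln_div ln_mult)
      then have "\<pi> i j * (payoff i j / \<kappa> - ln (\<pi> i j / b i) - ln Z) \<le> \<pi> i j * (x - 1)"
        using ln_le_minus_one[OF x] p by simp
      also have "\<dots> = b i * exp (payoff i j / \<kappa>) / Z - \<pi> i j"
        unfolding x_def using Z p by (simp add: field_simps)
      finally show ?thesis .
    qed
    have "(\<Sum>i=1..N. \<pi> i j * (payoff i j / \<kappa> - ln (\<pi> i j / b i))) - ln Z
        = (\<Sum>i=1..N. \<pi> i j * (payoff i j / \<kappa> - ln (\<pi> i j / b i) - ln Z))"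
      using choice_rule_sum[OF assms(3) j]
      by (simp add: right_diff_distrib[of _ _ "ln Z"] sum_subtractf flip: sum_distrib_right)
    also have "\<dots> \<le> (\<Sum>i=1..N. b i * exp (payoff i j / \<kappa>) / Z - \<pi> i j)"
      by (rule sum_mono) (rule gibbs)
    also have "\<dots> = 0"
      using choice_rule_sum[OF assms(3) j] logit_normalizer[OF bS j, of \<kappa>] Z
      by (simp add: sum_subtractf Z_def flip: sum_divide_distrib)
    finally show ?thesis
      using muj by simp
  qed simp
  then show "\<mu> j * (\<Sum>i=1..N. \<pi> i j * (payoff i j / \<kappa> - ln (\<pi> i j / marginal N \<mu> \<pi> i)))
      \<le> \<mu> j * ln (1 + gain \<kappa> * marginal N \<mu> \<pi> j)"
    by (simp add: b_def Z_def)
qed (use assms(1) in simp)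

text \<open>For a logit rule the payoff term cancels against the log-likelihood ratio, leaving the
  log-normalizer for every action with positive marginal; the others have probability zero.\<close>

lemma agent_objective_logit:
  assumes "\<kappa> > 0" "\<mu> \<in> simplex N" "A \<subseteq> {1..N}" "\<pi> \<in> choice_rules N A" "logit N \<kappa> \<mu> A \<pi>"
  shows "agent_objective N \<kappa> \<mu> \<pi> =
    \<kappa> * (\<Sum>j=1..N. \<mu> j * ln (1 + gain \<kappa> * marginal N \<mu> \<pi> j))"
proof -
  define b where "b = marginal N \<mu> \<pi>"
  have bS: "b \<in> simplex N"
    unfolding b_def using assms(2,4) by (rule marginal_simplex)
  have "(\<Sum>i=1..N. \<pi> i j * (payoff i j / \<kappa> - ln (\<pi> i j / b i))) = ln (1 + gain \<kappa> * b j)"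
    if j: "j \<in> {1..N}" for j
  proof -
    have Z: "0 < 1 + gain \<kappa> * b j"
      using assms(1) bS j by (rule one_plus_gain_pos)
    have "\<pi> i j * (payoff i j / \<kappa> - ln (\<pi> i j / b i)) = \<pi> i j * ln (1 + gain \<kappa> * b j)"
      if i: "i \<in> {1..N}" for i
    proof (cases "b i = 0")
      case False
      then have "\<pi> i j / b i = exp (payoff i j / \<kappa>) / (1 + gain \<kappa> * b j)"
        using logit_eq[OF assms(2-5) i j] by (simp add: b_def)
      then show ?thesis
        using Z by (simp add: ln_div)
    qed (use logit_eq[OF assms(2-5) i j] in \<open>simp add: b_def\<close>)
    then have "(\<Sum>i=1..N. \<pi> i j * (payoff i j / \<kappa> - ln (\<pi> i j / b i)))
        = (\<Sum>i=1..N. \<pi> i j * ln (1 + gain \<kappa> * b j))"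
      by (rule sum.cong[OF refl])
    then show ?thesis
      using choice_rule_sum[OF assms(4) j] by (simp flip: sum_distrib_right)
  qed
  then show ?thesis
    unfolding agent_objective_eq[OF assms(1)] b_def by simp
qed

section \<open>The agent's optimum by water-filling\<close>

text \<open>The multiplier is found by the intermediate value theorem: \<open>f t / d\<close> is the
  total mass of the candidate for \<open>c = 1 / t\<close>, and \<open>t\<close> is tuned to make it
  one.\<close>

lemma waterfilling_exists:
  assumes d: "0 < d" and \<mu>: "\<mu> \<in> simplex N"
  obtains c b where "waterfilling N d \<mu> c b"
proof -
  define f where "f t = (\<Sum>j=1..N. max 0 (\<mu> j * t - 1))" for t
  have "continuous_on {0..real N + d} f"
    unfolding f_def by (intro continuous_intros)
  moreover have "f 0 = 0"
    by (simp add: f_def)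
  \<comment> \<open>Dropping the maxima leaves \<open>t - N\<close> as a lower bound for
    \<open>f t\<close>, which fixes the upper end of the interval.\<close>
  moreover have "d \<le> f (real N + d)"
  proof -
    have "d = (\<Sum>j=1..N. \<mu> j * (real N + d) - 1)"
      using simplex_sum[OF \<mu>] by (simp add: sum_subtractf flip: sum_distrib_right)
    also have "\<dots> \<le> f (real N + d)"
      unfolding f_def by (rule sum_mono) simp
    finally show ?thesis .
  qed
  ultimately obtain t where t: "0 \<le> t" "f t = d"
    using IVT'[of f 0 d "real N + d"] d by auto
  with d \<open>f 0 = 0\<close> have tp: "0 < t"
    by (cases "t = 0") auto
  define b where "b j = max 0 (\<mu> j * t - 1) / d" for j
  have "(\<Sum>j=1..N. b j) = 1"
    using t(2) d by (simp add: b_def f_def flip: sum_divide_distrib)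
  then have "b \<in> simplex N"
    using d by (simp add: simplex_def b_def)
  \<comment> \<open>Multiplied by \<open>c = 1 / t\<close> this reads
    \<open>c * (1 + d * b j) = max c (\<mu> j)\<close>, the first-order condition.\<close>
  moreover have "1 + d * b j = max 1 (\<mu> j * t)" for j
    using d by (auto simp: b_def max_def)
  ultimately have "waterfilling N d \<mu> (1 / t) b"
    using tp d by (auto simp: waterfilling_def max_def b_def field_simps split: if_splits)
  then show ?thesis
    by (rule that)
qed

text \<open>A tangent argument: each change \<open>D j\<close> is at most the linear term
  \<open>L j\<close>, and the \<open>L j\<close> sum to zero because both marginals have mass one.
  Equality in the logarithm's tangent bound gives uniqueness of the optimal marginal.\<close>

lemma waterfilling_maximizes_agent:
  assumes \<kappa>: "\<kappa> > 0" and \<mu>: "\<mu> \<in> simplex N" and wf: "waterfilling N (gain \<kappa>) \<mu> c b"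
    and \<pi>: "\<pi> \<in> choice_rules N A"
  shows "agent_objective N \<kappa> \<mu> \<pi> \<le> \<kappa> * (\<Sum>j=1..N. \<mu> j * ln (1 + gain \<kappa> * b j))" (is ?le)
    and "\<kappa> * (\<Sum>j=1..N. \<mu> j * ln (1 + gain \<kappa> * b j)) \<le> agent_objective N \<kappa> \<mu> \<pi>
      \<Longrightarrow> j \<in> {1..N} \<Longrightarrow> marginal N \<mu> \<pi> j = b j"
proof -
  define g where "g = marginal N \<mu> \<pi>"
  define D where "D j = \<mu> j * ln (1 + gain \<kappa> * g j) - \<mu> j * ln (1 + gain \<kappa> * b j)" for j
  define L where "L j = c * gain \<kappa> * (g j - b j)" for j
  have gS: "g \<in> simplex N"
    unfolding g_def using \<mu> \<pi> by (rule marginal_simplex)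
  have bS: "b \<in> simplex N" and c: "0 < c"
    using wf by (auto simp: waterfilling_def)
  note gp = gain_pos[OF \<kappa>]
  have L0: "(\<Sum>j=1..N. L j) = 0"
    using simplex_sum[OF gS] simplex_sum[OF bS]
    by (simp add: L_def sum_subtractf flip: sum_distrib_left)
  have DL: "D j \<le> L j" and DL_eq: "D j = L j \<Longrightarrow> \<mu> j \<noteq> 0 \<Longrightarrow> g j = b j" if j: "j \<in> {1..N}" for j
  proof -
    define x where "x = (1 + gain \<kappa> * g j) / (1 + gain \<kappa> * b j)"
    have G: "0 < 1 + gain \<kappa> * g j" and B: "0 < 1 + gain \<kappa> * b j"
      using one_plus_gain_pos[OF \<kappa> gS j] one_plus_gain_pos[OF \<kappa> bS j] .
    have x: "0 < x"
      unfolding x_def using G B by simp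
    have D: "D j = \<mu> j * ln x"
      unfolding D_def x_def using G B by (simp add: ln_div right_diff_distrib)
    have le1: "\<mu> j * ln x \<le> \<mu> j * (x - 1)"
      using ln_le_minus_one[OF x] simplex_nonneg[OF \<mu> j] by (rule mult_left_mono)
    have x1: "x - 1 = gain \<kappa> * (g j - b j) / (1 + gain \<kappa> * b j)"
      unfolding x_def using B by (simp add: field_simps)
    have le2: "\<mu> j * (x - 1) \<le> L j"
    \<comment> \<open>On the support of \<open>b\<close> the first-order condition gives equality;
      off it, the condition's inequality is multiplied by \<open>g j \<ge> 0\<close>.\<close>
    proof (cases "b j = 0")
      case True
      have "\<mu> j \<le> c * (1 + gain \<kappa> * b j)"
        using wf j unfolding waterfilling_def by blast
      then have "\<mu> j \<le> c" and "x - 1 = gain \<kappa> * g j"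
        using True x1 by auto
      then show ?thesis
        using True simplex_nonneg[OF gS j] gp by (simp add: L_def mult_right_mono mult.assoc)
    next
      case False
      then have "\<mu> j = c * (1 + gain \<kappa> * b j)"
        using wf j simplex_nonneg[OF bS j] by (auto simp: waterfilling_def)
      then show ?thesis
        using x1 B by (simp add: L_def)
    qed
    show "D j \<le> L j"
      using D le1 le2 by simp
    show "g j = b j" if "D j = L j" "\<mu> j \<noteq> 0"
    proof -
      have "\<mu> j * ln x = \<mu> j * (x - 1)"
        using D le1 le2 that by simp
      then have "x = 1"
        using that ln_eq_minus_one[OF x] by simp
      then show ?thesis
        using x1 B gp by simp
    qed
  qed
  have sumD: "\<kappa> * (\<Sum>j=1..N. \<mu> j * ln (1 + gain \<kappa> * g j))
      = \<kappa> * (\<Sum>j=1..N. \<mu> j * ln (1 + gain \<kappa> * b j)) + \<kappa> * (\<Sum>j=1..N. D j)"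
    by (simp add: D_def sum_subtractf right_diff_distrib)
  have "(\<Sum>j=1..N. D j) \<le> (\<Sum>j=1..N. L j)"
    by (rule sum_mono) (rule DL)
  then have D0: "(\<Sum>j=1..N. D j) \<le> 0"
    by (simp only: L0)
  have obj: "agent_objective N \<kappa> \<mu> \<pi> \<le> \<kappa> * (\<Sum>j=1..N. \<mu> j * ln (1 + gain \<kappa> * g j))"
    unfolding g_def using \<kappa> \<mu> \<pi> by (rule agent_objective_le)
  then show ?le
    using sumD mult_nonneg_nonpos[OF less_imp_le[OF \<kappa>] D0] by linarith
  show "marginal N \<mu> \<pi> j = b j"
    if ge: "\<kappa> * (\<Sum>j=1..N. \<mu> j * ln (1 + gain \<kappa> * b j)) \<le> agent_objective N \<kappa> \<mu> \<pi>"
      and j: "j \<in> {1..N}" for j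
  proof -
    have "0 \<le> \<kappa> * (\<Sum>j=1..N. D j)"
      using ge obj sumD by linarith
    \<comment> \<open>The sum of \<open>D\<close> is squeezed to zero, so each of the nonnegative
      gaps \<open>L j - D j\<close> vanishes.\<close>
    then have "(\<Sum>j=1..N. L j - D j) = 0"
      using \<kappa> D0 L0 by (simp add: sum_subtractf zero_le_mult_iff)
    then have "\<forall>j\<in>{1..N}. L j - D j = 0"
      using DL by (subst (asm) sum_nonneg_eq_0_iff) auto
    then have eq: "g j = b j" if "j \<in> {1..N}" "\<mu> j \<noteq> 0" for j
      using DL_eq that by simp
    \<comment> \<open>Where the prior vanishes \<open>b\<close> does too, so \<open>b \<le> g\<close>, and both have total mass one.\<close>
    have le: "b j \<le> g j" if "j \<in> {1..N}" for j
    proof (cases "\<mu> j = 0")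
      case True
      then have "\<not> 0 < b j"
        using wf that c one_plus_gain_pos[OF \<kappa> bS that] by (auto simp: waterfilling_def)
      then show ?thesis
        using simplex_nonneg[OF gS that] by simp
    qed (use eq[OF that] in simp)
    have "(\<Sum>j=1..N. g j - b j) = 0"
      using simplex_sum[OF gS] simplex_sum[OF bS] by (simp add: sum_subtractf)
    then have "\<forall>j\<in>{1..N}. g j - b j = 0"
      using le by (subst (asm) sum_nonneg_eq_0_iff) auto
    with j show ?thesis
      by (simp add: g_def)
  qed
qed

text \<open>The bound is attained by the logit rule built from \<open>b\<close>. The point to check
  is self-consistency: the marginal of this rule must be \<open>b\<close> again.\<close>

lemma waterfilling_rule:
  assumes \<kappa>: "\<kappa> > 0" and \<mu>: "\<mu> \<in> simplex N" and wf: "waterfilling N (gain \<kappa>) \<mu> c b"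
  obtains \<pi> where "\<pi> \<in> choice_rules N {1..N}" "logit N \<kappa> \<mu> {1..N} \<pi>"
    "agent_objective N \<kappa> \<mu> \<pi> = \<kappa> * (\<Sum>j=1..N. \<mu> j * ln (1 + gain \<kappa> * b j))"
proof -
  define \<pi> where "\<pi> i j = b i * exp (payoff i j / \<kappa>) / (1 + gain \<kappa> * b j)" for i j
  have bS: "b \<in> simplex N"
    using wf by (auto simp: waterfilling_def)
  note Z = one_plus_gain_pos[OF \<kappa> bS]
  have "(\<Sum>i=1..N. \<pi> i j) = 1" if "j \<in> {1..N}" for j
    using Z[OF that] logit_normalizer[OF bS that, of \<kappa>] by (simp add: \<pi>_def flip: sum_divide_distrib)
  moreover have "0 \<le> \<pi> i j" if "i \<in> {1..N}" "j \<in> {1..N}" for i j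
    using Z[OF that(2)] simplex_nonneg[OF bS that(1)] by (simp add: \<pi>_def)
  ultimately have \<pi>: "\<pi> \<in> choice_rules N {1..N}"
    by (simp add: choice_rules_def simplex_def)
  \<comment> \<open>The marginal of \<open>\<pi>\<close> at \<open>i\<close> is \<open>b i\<close>
    times the sum of all \<open>q j\<close> plus \<open>gain \<kappa> * q i\<close>. As
    \<open>q\<close> equals \<open>c\<close> on the support of \<open>b\<close>, self-consistency
    reduces to fact \<open>q\<close> below, obtained by summing the prior to one.\<close>
  define q where "q j = \<mu> j / (1 + gain \<kappa> * b j)" for j
  have qb: "q j * b j = c * b j" if "j \<in> {1..N}" for j
  proof (cases "b j = 0")
    case False
    then have "\<mu> j = c * (1 + gain \<kappa> * b j)"
      using wf that simplex_nonneg[OF bS that] by (auto simp: waterfilling_def)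
    then show ?thesis
      using Z[OF that] by (simp add: q_def)
  qed simp
  have "1 = (\<Sum>j=1..N. q j + gain \<kappa> * (q j * b j))"
    unfolding simplex_sum[OF \<mu>, symmetric]
  proof (rule sum.cong)
    fix j assume "j \<in> {1..N}"
    from Z[OF this] have "\<mu> j = q j * (1 + gain \<kappa> * b j)"
      by (simp add: q_def)
    then show "\<mu> j = q j + gain \<kappa> * (q j * b j)"
      by (simp only: algebra_simps mult_1_right)
  qed simp
  also have "\<dots> = (\<Sum>j=1..N. q j + gain \<kappa> * (c * b j))"
    by (rule sum.cong) (auto simp: qb)
  also have "\<dots> = (\<Sum>j=1..N. q j) + gain \<kappa> * c"
    using simplex_sum[OF bS] by (simp add: sum.distrib flip: sum_distrib_left)
  finally have q: "(\<Sum>j=1..N. q j) + gain \<kappa> * c = 1"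
    by simp
  have marg: "marginal N \<mu> \<pi> i = b i" if i: "i \<in> {1..N}" for i
  proof -
    have "marginal N \<mu> \<pi> i = (\<Sum>j=1..N. b i * q j + (if j = i then gain \<kappa> * (q j * b j) else 0))"
      unfolding marginal_def
      by (rule sum.cong) (auto simp: \<pi>_def q_def exp_payoff add_divide_distrib algebra_simps)
    also have "\<dots> = b i * (\<Sum>j=1..N. q j) + gain \<kappa> * (c * b i)"
      using i qb[OF i] by (simp add: sum.distrib sum.delta flip: sum_distrib_left)
    also have "\<dots> = b i * ((\<Sum>j=1..N. q j) + gain \<kappa> * c)"
      by (simp add: algebra_simps)
    finally show ?thesis
      by (simp add: q)
  qed
  have "(\<Sum>k=1..N. marginal N \<mu> \<pi> k * exp (payoff k j / \<kappa>)) = 1 + gain \<kappa> * b j"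
    if "j \<in> {1..N}" for j
    using logit_normalizer[OF bS that, of \<kappa>] by (simp add: marg)
  then have logit: "logit N \<kappa> \<mu> {1..N} \<pi>"
    by (simp add: logit_def marg) (simp add: \<pi>_def)
  have "agent_objective N \<kappa> \<mu> \<pi> = \<kappa> * (\<Sum>j=1..N. \<mu> j * ln (1 + gain \<kappa> * b j))"
    using agent_objective_logit[OF \<kappa> \<mu> order.refl \<pi> logit] by (simp add: marg)
  with \<pi> logit show ?thesis
    by (rule that)
qed

text \<open>The principal's problem ranges over every solution of the agent, and uniqueness of the
  marginal gives all of them the same payoff.\<close>

lemma solves_agent_marginal:
  assumes \<kappa>: "\<kappa> > 0" and \<mu>: "\<mu> \<in> simplex N" and wf: "waterfilling N (gain \<kappa>) \<mu> c b"
    and \<pi>: "solves_agent N \<kappa> \<mu> {1..N} \<pi>" and j: "j \<in> {1..N}"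
  shows "marginal N \<mu> \<pi> j = b j"
proof -
  obtain \<rho> where \<rho>: "\<rho> \<in> choice_rules N {1..N}"
    "agent_objective N \<kappa> \<mu> \<rho> = \<kappa> * (\<Sum>j=1..N. \<mu> j * ln (1 + gain \<kappa> * b j))"
    using waterfilling_rule[OF \<kappa> \<mu> wf] .
  with \<pi> have "\<kappa> * (\<Sum>j=1..N. \<mu> j * ln (1 + gain \<kappa> * b j)) \<le> agent_objective N \<kappa> \<mu> \<pi>"
    by (auto simp: solves_agent_def)
  moreover have "\<pi> \<in> choice_rules N {1..N}"
    using \<pi> by (simp add: solves_agent_def)
  ultimately show ?thesis
    using waterfilling_maximizes_agent(2)[OF \<kappa> \<mu> wf] j by blast
qed

section \<open>The principal's concave program\<close>

text \<open>The slope of \<open>y / (1 + d * y)\<close> is \<open>1 / (1 + d * y)\<^sup>2\<close>,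
  and the gap to the tangent is an explicit nonnegative fraction.\<close>

lemma concave_tangent_bound:
  fixes d x y :: real
  assumes "0 \<le> d" "0 \<le> x" "0 \<le> y"
  shows "x / (1 + d * x) - y / (1 + d * y) \<le> (x - y) / (1 + d * y)\<^sup>2"
proof -
  have X: "0 < 1 + d * x" and Y: "0 < 1 + d * y"
    using assms by (simp_all add: add_pos_nonneg)
  have "(x - y) / (1 + d * y)\<^sup>2 - (x / (1 + d * x) - y / (1 + d * y))
      = d * (x - y)\<^sup>2 / ((1 + d * x) * (1 + d * y)\<^sup>2)"
    using X Y by (simp add: divide_simps) (simp add: algebra_simps power2_eq_square)
  also have "\<dots> \<ge> 0"
    using X Y assms by simp
  finally show ?thesis
    by simp
qed

text \<open>Squaring the agent's first-order condition for a prior proportional to the square root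
  of \<open>\<nu>\<close> yields the principal's, with multiplier \<open>(c / s)\<^sup>2\<close>.
  The competitor \<open>g\<close> is any point of the simplex, whichever prior and delegation set
  induce it.\<close>

lemma waterfilling_maximizes_principal:
  assumes d: "0 < d" and wf: "waterfilling N d (\<lambda>j. s * sqrt (\<nu> j)) c b" and s: "0 < s"
    and \<nu>: "\<nu> \<in> simplex N" and g: "g \<in> simplex N"
  shows "(\<Sum>j=1..N. \<nu> j * (g j / (1 + d * g j))) \<le> (\<Sum>j=1..N. \<nu> j * (b j / (1 + d * b j)))"
proof -
  have bS: "b \<in> simplex N" and c: "0 < c"
    using wf by (auto simp: waterfilling_def)
  have "\<nu> j * (g j / (1 + d * g j)) - \<nu> j * (b j / (1 + d * b j)) \<le> (c / s)\<^sup>2 * (g j - b j)"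
    if j: "j \<in> {1..N}" for j
  proof -
    have g0: "0 \<le> g j" and b0: "0 \<le> b j" and n0: "0 \<le> \<nu> j"
      using simplex_nonneg[OF g j] simplex_nonneg[OF bS j] simplex_nonneg[OF \<nu> j] .
    have B: "0 < 1 + d * b j"
      using d b0 by (simp add: add_pos_nonneg)
    have sq: "\<nu> j = (sqrt (\<nu> j))\<^sup>2"
      using n0 by simp
    have "\<nu> j * (g j / (1 + d * g j)) - \<nu> j * (b j / (1 + d * b j))
        \<le> \<nu> j * ((g j - b j) / (1 + d * b j)\<^sup>2)"
      using mult_left_mono[OF concave_tangent_bound n0, of d "g j" "b j"] d g0 b0
      by (simp add: right_diff_distrib)
    also have "\<dots> \<le> (c / s)\<^sup>2 * (g j - b j)"
    proof (cases "b j = 0")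
      case True
      have "s * sqrt (\<nu> j) \<le> c * (1 + d * b j)"
        using wf j unfolding waterfilling_def by blast
      with True have "s * sqrt (\<nu> j) \<le> c"
        by simp
      then have "sqrt (\<nu> j) \<le> c / s"
        using s by (simp add: field_simps)
      then have "(sqrt (\<nu> j))\<^sup>2 \<le> (c / s)\<^sup>2"
        using n0 by (intro power_mono) auto
      then have "\<nu> j \<le> (c / s)\<^sup>2"
        by (simp only: sq[symmetric])
      then show ?thesis
        using True g0 by (simp add: mult_right_mono)
    next
      case False
      then have "s * sqrt (\<nu> j) = c * (1 + d * b j)"
        using wf j b0 by (auto simp: waterfilling_def)
      then have "sqrt (\<nu> j) = c / s * (1 + d * b j)"
        using s by (simp add: field_simps)
      then have "\<nu> j = (c / s)\<^sup>2 * (1 + d * b j)\<^sup>2"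
        by (subst sq) (simp only: power_mult_distrib)
      then show ?thesis
        using B by simp
    qed
    finally show ?thesis .
  qed
  then have "(\<Sum>j=1..N. \<nu> j * (g j / (1 + d * g j)) - \<nu> j * (b j / (1 + d * b j)))
      \<le> (\<Sum>j=1..N. (c / s)\<^sup>2 * (g j - b j))"
    by (rule sum_mono)
  also have "\<dots> = 0"
    using simplex_sum[OF g] simplex_sum[OF bS] by (simp add: sum_subtractf flip: sum_distrib_left)
  finally show ?thesis
    by (simp add: sum_subtractf)
qed

theorem proposition3:
  fixes N :: nat and \<kappa> :: real and \<mu>p :: "nat \<Rightarrow> real"
  assumes "N > 2"
    and "\<kappa> > 0"
    and "\<mu>p \<in> simplex N"
    and "\<And>i j. 1 \<le> i \<Longrightarrow> i \<le> j \<Longrightarrow> j \<le> N \<Longrightarrow> \<mu>p j \<le> \<mu>p i"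
  shows "solves_restriction_problem N \<kappa> \<mu>p
           (\<lambda>i. sqrt (\<mu>p i) / (\<Sum>j=1..N. sqrt (\<mu>p j))) {1..N}"
proof -
  define S where "S = (\<Sum>j=1..N. sqrt (\<mu>p j))"
  define \<mu> where "\<mu> = (\<lambda>i. sqrt (\<mu>p i) / S)"
  note \<kappa> = assms(2) and \<mu>p = assms(3)
  have "S \<noteq> 0"
  proof
    assume "S = 0"
    then have "\<forall>j\<in>{1..N}. sqrt (\<mu>p j) = 0"
      using simplex_nonneg[OF \<mu>p] unfolding S_def by (subst (asm) sum_nonneg_eq_0_iff) auto
    then show False
      using simplex_sum[OF \<mu>p] by simp
  qed
  moreover have "0 \<le> S"
    unfolding S_def using simplex_nonneg[OF \<mu>p] by (intro sum_nonneg) auto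
  ultimately have S: "0 < S"
    by simp
  then have \<mu>: "\<mu> \<in> simplex N"
    using simplex_nonneg[OF \<mu>p]
    by (auto simp: simplex_def \<mu>_def simp flip: sum_divide_distrib) (simp add: S_def)
  obtain c b where wf: "waterfilling N (gain \<kappa>) \<mu> c b"
    using waterfilling_exists[OF gain_pos[OF \<kappa>] \<mu>] .
  obtain \<rho> where \<rho>: "\<rho> \<in> choice_rules N {1..N}" "logit N \<kappa> \<mu> {1..N} \<rho>"
    "agent_objective N \<kappa> \<mu> \<rho> = \<kappa> * (\<Sum>j=1..N. \<mu> j * ln (1 + gain \<kappa> * b j))"
    using waterfilling_rule[OF \<kappa> \<mu> wf] .
  then have "solves_agent N \<kappa> \<mu> {1..N} \<rho>"
    using waterfilling_maximizes_agent(1)[OF \<kappa> \<mu> wf] by (simp add: solves_agent_def)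
  then have ex: "feasible N \<kappa> \<mu> {1..N} \<rho>"
    using \<mu> assms(1) by (simp add: feasible_def)
  have opt: "expected_payoff N \<mu>p \<pi>' \<le> expected_payoff N \<mu>p \<pi>"
    if \<pi>: "feasible N \<kappa> \<mu> {1..N} \<pi>" and \<pi>': "feasible N \<kappa> \<mu>' A' \<pi>'" for \<pi> \<mu>' A' \<pi>'
  \<comment> \<open>Both payoffs become \<open>1 + gain \<kappa>\<close> times the principal's
    separable objective, at \<open>b\<close> and at the competitor's marginal
    \<open>g\<close>.\<close>
  proof -
    define g where "g = marginal N \<mu>' \<pi>'"
    have f': "\<mu>' \<in> simplex N" "A' \<subseteq> {1..N}" "\<pi>' \<in> choice_rules N A'" "logit N \<kappa> \<mu>' A' \<pi>'"
      using \<pi>' by (auto simp: feasible_def solves_agent_def)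
    have f: "\<mu> \<in> simplex N" "{1..N} \<subseteq> {1..N}" "\<pi> \<in> choice_rules N {1..N}"
      "logit N \<kappa> \<mu> {1..N} \<pi>"
      using \<pi> by (auto simp: feasible_def solves_agent_def)
    have "marginal N \<mu> \<pi> j = b j" if "j \<in> {1..N}" for j
      using solves_agent_marginal[OF \<kappa> \<mu> wf _ that] \<pi> by (simp add: feasible_def)
    then have val: "expected_payoff N \<mu>p \<pi>
        = (1 + gain \<kappa>) * (\<Sum>j=1..N. \<mu>p j * (b j / (1 + gain \<kappa> * b j)))"
      unfolding logit_expected_payoff[OF f] sum_distrib_left by (intro sum.cong) auto
    have "expected_payoff N \<mu>p \<pi>'
        = (1 + gain \<kappa>) * (\<Sum>j=1..N. \<mu>p j * (g j / (1 + gain \<kappa> * g j)))"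
      unfolding logit_expected_payoff[OF f'] sum_distrib_left g_def by (intro sum.cong) auto
    also have "\<dots> \<le> (1 + gain \<kappa>) * (\<Sum>j=1..N. \<mu>p j * (b j / (1 + gain \<kappa> * b j)))"
    proof (rule mult_left_mono)
      have "waterfilling N (gain \<kappa>) (\<lambda>j. 1 / S * sqrt (\<mu>p j)) c b"
        using wf by (simp add: \<mu>_def)
      then show "(\<Sum>j=1..N. \<mu>p j * (g j / (1 + gain \<kappa> * g j)))
          \<le> (\<Sum>j=1..N. \<mu>p j * (b j / (1 + gain \<kappa> * b j)))"
        using S \<mu>p marginal_simplex[OF f'(1,3)] unfolding g_def
        by (intro waterfilling_maximizes_principal[OF gain_pos[OF \<kappa>], where s = "1 / S"]) auto
    qed (use gain_pos[OF \<kappa>] in simp)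
    finally show ?thesis
      by (simp only: val)
  qed
  show ?thesis
    using ex opt unfolding solves_restriction_problem_def \<mu>_def S_def by blast
qed

end
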